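(* A Lipschitz quotient of a compact purely $1$-unrectifiable metric space is purely $1$-unrectifiable. That is, if $M$ is a compact purely $1$-unrectifiable metric space, $N$ is a metric space, and there exists a Lipschitz quotient map $f\colon M\to N$, then $N$ is purely $1$-unrectifiable.
   Context: For a metric space $M$, $B_M(x,r)$ denotes the closed ball of center $x$ and radius $r$. The co-Lipschitz constant $\text{co-Lip}(f)$ of a map $f\colon M\to N$ between metric spaces is the infimum of all $C>0$ such that $B_N(f(x),r)\subset f(B_M(x,Cr))$ for all $x\in M$ and all $r>0$; $f$ is co-Lipschitz if $\text{co-Lip}(f)<\infty$. A Lipschitz quotient map is a map that is both Lipschitz and co-Lipschitz. $N$ is a Lipschitz quotient of $M$ if there is a Lipschitz quotient map $M\to N$. A metric space is purely $1$-unrectifiable if it does not contain any bi-Lipschitz copy of a subset of $\mathbb{R}$ of positive Lebesgue measure. *)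

theory Defs
  imports "HOL-Analysis.Analysis"
begin

text \<open>
  Metric spaces are subsets \<open>M\<close>, \<open>N\<close> of types of class \<open>metric_space\<close>, carrying the restricted metric.
  The closed ball of \<open>M\<close> with center \<open>x\<close> and radius \<open>r\<close> is therefore \<open>cball x r \<inter> M\<close>.
\<close>

text \<open>
  The infimum is taken in the extended reals, so that it is \<open>\<infinity>\<close> when there is no admissible constant.
\<close>
definition co_Lip ::
  "'a::metric_space set \<Rightarrow> 'b::metric_space set \<Rightarrow> ('a \<Rightarrow> 'b) \<Rightarrow> ereal" where
  "co_Lip M N f =
     Inf (ereal ` {C. 0 < C \<and>
       (\<forall>x\<in>M. \<forall>r>0. cball (f x) r \<inter> N \<subseteq> f ` (cball x (C * r) \<inter> M))})"

definition co_lipschitz ::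
  "'a::metric_space set \<Rightarrow> 'b::metric_space set \<Rightarrow> ('a \<Rightarrow> 'b) \<Rightarrow> bool" where
  "co_lipschitz M N f \<longleftrightarrow> co_Lip M N f < \<infinity>"

definition lipschitz_quotient_map ::
  "'a::metric_space set \<Rightarrow> 'b::metric_space set \<Rightarrow> ('a \<Rightarrow> 'b) \<Rightarrow> bool" where
  "lipschitz_quotient_map M N f \<longleftrightarrow>
     f \<in> M \<rightarrow> N \<and> (\<exists>L. L-lipschitz_on M f) \<and> co_lipschitz M N f"

definition lipschitz_quotient ::
  "'a::metric_space set \<Rightarrow> 'b::metric_space set \<Rightarrow> bool" where
  "lipschitz_quotient M N \<longleftrightarrow> (\<exists>f. lipschitz_quotient_map M N f)"

definition bilipschitz_on ::
  "'a::metric_space set \<Rightarrow> ('a \<Rightarrow> 'b::metric_space) \<Rightarrow> bool" where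
  "bilipschitz_on A g \<longleftrightarrow>
     (\<exists>c>0. \<exists>C. \<forall>x\<in>A. \<forall>y\<in>A.
        c * dist x y \<le> dist (g x) (g y) \<and> dist (g x) (g y) \<le> C * dist x y)"

definition purely_1_unrectifiable :: "'a::metric_space set \<Rightarrow> bool" where
  "purely_1_unrectifiable M \<longleftrightarrow>
     \<not> (\<exists>(A::real set) g. A \<in> sets lebesgue \<and> emeasure lebesgue A > 0 \<and>
          g \<in> A \<rightarrow> M \<and> bilipschitz_on A g)"

end

theory Submission
  imports Defs
begin

text \<open>
  A bi-Lipschitz curve fragment \<open>g : A \<rightarrow> N\<close> lifts through the quotient map \<open>f\<close>: over a finite subset
  of \<open>A\<close> one lifts the points from left to right, each time using co-Lipschitzness to keep the new
  point close to the previous one. As the points lie on a line, controlling consecutive distances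
  makes the lift Lipschitz with a constant independent of the finite set, so Tychonoff's theorem
  yields a Lipschitz lift \<open>\<gamma>\<close> on all of \<open>A\<close>. Since \<open>f \<circ> \<gamma> = g\<close> and \<open>f\<close> is Lipschitz, \<open>\<gamma>\<close> is bi-Lipschitz.
\<close>

text \<open>An infimum below \<infinity> forces the set of admissible constants to be nonempty. Any
  member of it serves, so it does not matter whether the infimum is attained.\<close>

lemma co_lipschitzE:
  assumes "co_lipschitz M N f"
  obtains C where "0 < C"
    and "\<And>x r. x \<in> M \<Longrightarrow> 0 < r \<Longrightarrow> cball (f x) r \<inter> N \<subseteq> f ` (cball x (C * r) \<inter> M)"
  using assms unfolding co_lipschitz_def co_Lip_def Inf_less_iff by blast

lemma co_lipschitz_surj:
  assumes "co_lipschitz M N f" "M \<noteq> {}"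
  shows "N \<subseteq> f ` M"
proof
  fix y assume "y \<in> N"
  obtain x where x: "x \<in> M" using assms(2) by blast
  obtain C where C: "\<And>x r. x \<in> M \<Longrightarrow> 0 < r \<Longrightarrow> cball (f x) r \<inter> N \<subseteq> f ` (cball x (C * r) \<inter> M)"
    using co_lipschitzE[OF assms(1)] by metis
  \<comment> \<open>The summand 1 keeps the radius positive when \<open>y = f x\<close>.\<close>
  have "y \<in> cball (f x) (dist (f x) y + 1) \<inter> N"
    using \<open>y \<in> N\<close> by simp
  moreover have "0 < dist (f x) y + 1"
    by (simp add: add_nonneg_pos)
  ultimately show "y \<in> f ` M"
    using C[OF x] by blast
qed

lemma finite_lipschitz_lift:
  fixes g :: "real \<Rightarrow> 'b::metric_space" and M :: "'a::metric_space set"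
  assumes f: "N \<subseteq> f ` M"
    and C: "\<And>x r. x \<in> M \<Longrightarrow> 0 < r \<Longrightarrow> cball (f x) r \<inter> N \<subseteq> f ` (cball x (C * r) \<inter> M)"
    and L: "0 < L" "L-lipschitz_on A g" and g: "g \<in> A \<rightarrow> N"
    and F: "finite F" "F \<subseteq> A"
  shows "\<exists>\<gamma>. (\<forall>t\<in>F. \<gamma> t \<in> M \<and> f (\<gamma> t) = g t) \<and>
             (\<forall>s\<in>F. \<forall>t\<in>F. dist (\<gamma> s) (\<gamma> t) \<le> C * L * dist s t)"
  using F
proof (induction F rule: finite_linorder_max_induct)
  case empty
  then show ?case by simp
next
  case (insert b F)
  then obtain \<gamma> where \<gamma>: "\<And>t. t \<in> F \<Longrightarrow> \<gamma> t \<in> M \<and> f (\<gamma> t) = g t"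
      "\<And>s t. s \<in> F \<Longrightarrow> t \<in> F \<Longrightarrow> dist (\<gamma> s) (\<gamma> t) \<le> C * L * dist s t"
    by (metis insert_subset)
  have b: "b \<notin> F" "b \<in> A" "g b \<in> N"
    using insert g by auto
  have "\<exists>x\<in>M. f x = g b \<and> (\<forall>s\<in>F. dist (\<gamma> s) x \<le> C * L * dist s b)"
  proof (cases "F = {}")
    case True
    moreover obtain x where "x \<in> M" "f x = g b"
      using subsetD[OF f b(3)] by force
    ultimately show ?thesis by blast
  next
    case False
    \<comment> \<open>The left neighbour of \<open>b\<close> in \<open>F\<close>: a preimage of
      \<open>g b\<close> chosen close to \<open>\<gamma> m\<close> is automatically close enough to
      every other \<open>\<gamma> s\<close>.\<close>
    define m where "m = Max F"
    have m: "m \<in> F" "m < b" "\<And>s. s \<in> F \<Longrightarrow> s \<le> m"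
      using False insert by (auto simp: m_def)
    have "dist (g m) (g b) \<le> L * dist m b"
      using lipschitz_onD[OF L(2)] m(1) b insert.prems by blast
    then have "g b \<in> cball (f (\<gamma> m)) (L * dist m b) \<inter> N"
      using \<gamma>(1)[OF m(1)] b by simp
    moreover have "0 < L * dist m b"
      using L(1) m(2) by simp
    ultimately obtain x where x: "x \<in> M" "f x = g b" "dist (\<gamma> m) x \<le> C * (L * dist m b)"
      using C[of "\<gamma> m" "L * dist m b"] \<gamma>(1)[OF m(1)] by auto
    have "dist (\<gamma> s) x \<le> C * L * dist s b" if "s \<in> F" for s
    proof -
      have "dist (\<gamma> s) x \<le> C * L * dist s m + C * L * dist m b"
        using dist_triangle[of "\<gamma> s" x "\<gamma> m"] \<gamma>(2)[OF that m(1)] x(3) by simp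
      also have "\<dots> = C * L * (dist s m + dist m b)"
        by (simp add: distrib_left)
      \<comment> \<open>Since \<open>s \<le> m < b\<close> on the line, the triangle inequality
        loses nothing here, so the constant \<open>C * L\<close> does not grow along the
        induction.\<close>
      also have "dist s m + dist m b = dist s b"
        using m(2) m(3)[OF that] by (simp add: dist_real_def)
      finally show ?thesis .
    qed
    then show ?thesis using x by blast
  qed
  then obtain x where x: "x \<in> M" "f x = g b"
      "\<And>s. s \<in> F \<Longrightarrow> dist (\<gamma> s) x \<le> C * L * dist s b"
    by blast
  show ?case
  proof (intro exI conjI ballI)
    fix t assume "t \<in> insert b F"
    then show "(\<gamma>(b := x)) t \<in> M" "f ((\<gamma>(b := x)) t) = g t"
      using \<gamma>(1) x by auto
  next
    fix s t assume "s \<in> insert b F" "t \<in> insert b F"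
    then show "dist ((\<gamma>(b := x)) s) ((\<gamma>(b := x)) t) \<le> C * L * dist s t"
      using \<gamma>(2) x(3)[of s] x(3)[of t] b(1) by (auto simp: dist_commute)
  qed
qed

text \<open>The product of the \<open>K i\<close> is compact by Tychonoff, and each bound on a pair
  of coordinates cuts out a closed set. Solvability over finite index sets is the finite
  intersection property of these sets.\<close>

lemma compact_selection:
  fixes K :: "'i \<Rightarrow> 'a::metric_space set"
  assumes K: "\<And>i. i \<in> I \<Longrightarrow> compact (K i)"
    and fin: "\<And>J. finite J \<Longrightarrow> J \<subseteq> I \<Longrightarrow>
      \<exists>\<gamma>. (\<forall>i\<in>J. \<gamma> i \<in> K i) \<and> (\<forall>i\<in>J. \<forall>j\<in>J. dist (\<gamma> i) (\<gamma> j) \<le> \<rho> i j)"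
  shows "\<exists>\<gamma>. (\<forall>i\<in>I. \<gamma> i \<in> K i) \<and> (\<forall>i\<in>I. \<forall>j\<in>I. dist (\<gamma> i) (\<gamma> j) \<le> \<rho> i j)"
proof -
  \<comment> \<open>Singleton factors outside \<open>I\<close> turn the product into one over the
    whole index type, where the product topology is the type class topology of the function
    space.\<close>
  define K' where "K' i = (if i \<in> I then K i else {undefined})" for i
  define S where "S = Pi\<^sub>E UNIV K'"
  define D where "D = (\<lambda>(i, j). {\<gamma> :: 'i \<Rightarrow> 'a. dist (\<gamma> i) (\<gamma> j) \<le> \<rho> i j})"
  have "compactin (product_topology (\<lambda>i. euclidean) UNIV) S"
    unfolding S_def compactin_PiE using K by (auto simp: K'_def)
  then have "compact S"
    by (simp add: euclidean_product_topology)
  moreover have "closed (D p)" for p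
    unfolding D_def
    by (cases p) (auto intro!: closed_Collect_le continuous_intros continuous_on_product_coordinates)
  moreover have "S \<inter> (\<Inter>p\<in>P. D p) \<noteq> {}" if P: "finite P" "P \<subseteq> I \<times> I" for P
  proof -
    \<comment> \<open>Finitely many constraints involve only the finitely many indices in
      \<open>J\<close>.\<close>
    define J where "J = fst ` P \<union> snd ` P"
    have "finite J" "J \<subseteq> I"
      using P by (auto simp: J_def)
    then obtain \<gamma> where \<gamma>: "\<And>i. i \<in> J \<Longrightarrow> \<gamma> i \<in> K i"
        "\<And>i j. i \<in> J \<Longrightarrow> j \<in> J \<Longrightarrow> dist (\<gamma> i) (\<gamma> j) \<le> \<rho> i j"
      using fin by meson
    \<comment> \<open>For \<open>i \<in> I\<close> the finite case \<open>{i}\<close> shows that the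
      factor is nonempty. The resulting points fill the coordinates outside \<open>J\<close>, which
      no constraint in \<open>P\<close> sees.\<close>
    have "\<exists>y. y \<in> K' i" for i
      using fin[of "{i}"] by (auto simp: K'_def)
    then obtain y where y: "\<And>i. y i \<in> K' i" by metis
    define \<gamma>' where "\<gamma>' i = (if i \<in> J then \<gamma> i else y i)" for i
    have "\<gamma>' i \<in> K' i" for i
      using \<gamma>(1)[of i] y[of i] subsetD[OF \<open>J \<subseteq> I\<close>, of i]
      by (auto simp: \<gamma>'_def K'_def split: if_splits)
    then have "\<gamma>' \<in> S"
      by (simp add: S_def PiE_iff)
    moreover have "\<gamma>' \<in> D p" if "p \<in> P" for p
    proof -
      have "fst p \<in> J" "snd p \<in> J" using that by (auto simp: J_def)
      then show ?thesis using \<gamma>(2) by (auto simp: D_def \<gamma>'_def split: prod.split)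
    qed
    ultimately show ?thesis by blast
  qed
  ultimately have "S \<inter> (\<Inter>p\<in>I \<times> I. D p) \<noteq> {}"
    by (rule compact_imp_fip_image)
  then obtain \<gamma> where "\<gamma> \<in> S" and "\<And>i j. i \<in> I \<Longrightarrow> j \<in> I \<Longrightarrow> \<gamma> \<in> D (i, j)"
    by blast
  then show ?thesis
    by (intro exI[of _ \<gamma>]) (auto simp: S_def K'_def D_def PiE_iff split: if_splits)
qed

lemma lipschitz_lift:
  fixes g :: "real \<Rightarrow> 'b::metric_space" and M :: "'a::metric_space set"
  assumes M: "compact M" "M \<noteq> {}"
    and f: "continuous_on M f" "co_lipschitz M N f"
    and g: "L-lipschitz_on A g" "g \<in> A \<rightarrow> N"
  obtains \<gamma> C where "\<gamma> \<in> A \<rightarrow> M" "\<And>t. t \<in> A \<Longrightarrow> f (\<gamma> t) = g t" "C-lipschitz_on A \<gamma>"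
proof -
  obtain C where C: "0 < C"
    "\<And>x r. x \<in> M \<Longrightarrow> 0 < r \<Longrightarrow> cball (f x) r \<inter> N \<subseteq> f ` (cball x (C * r) \<inter> M)"
    using co_lipschitzE[OF f(2)] by metis
  \<comment> \<open>\<open>L\<close> may be 0, but the finite lift needs balls of positive
    radius.\<close>
  have L: "0 < L + 1" "(L + 1)-lipschitz_on A g"
    using lipschitz_on_nonneg[OF g(1)] lipschitz_on_le[OF g(1)] by auto
  \<comment> \<open>A selection from these fibres is exactly a lift of \<open>g\<close>. They are
    compact, being closed in \<open>M\<close>.\<close>
  define K where "K t = {x \<in> M. f x = g t}" for t
  have "compact (K t)" for t
  proof -
    have "closed (M \<inter> f -` {g t})"
      using f(1) M(1) by (intro continuous_closed_preimage compact_imp_closed) auto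
    then have "compact (M \<inter> (M \<inter> f -` {g t}))"
      using M(1) by (rule compact_Int_closed[rotated])
    also have "M \<inter> (M \<inter> f -` {g t}) = K t" by (auto simp: K_def)
    finally show ?thesis .
  qed
  moreover have "\<exists>\<gamma>. (\<forall>t\<in>F. \<gamma> t \<in> K t) \<and>
      (\<forall>s\<in>F. \<forall>t\<in>F. dist (\<gamma> s) (\<gamma> t) \<le> C * (L + 1) * dist s t)" if "finite F" "F \<subseteq> A" for F
    using finite_lipschitz_lift[OF co_lipschitz_surj[OF f(2) M(2)] C(2) L g(2) that]
    by (simp add: K_def)
  ultimately have "\<exists>\<gamma>. (\<forall>t\<in>A. \<gamma> t \<in> K t) \<and>
      (\<forall>s\<in>A. \<forall>t\<in>A. dist (\<gamma> s) (\<gamma> t) \<le> C * (L + 1) * dist s t)"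
    by (rule compact_selection)
  then obtain \<gamma> where \<gamma>: "\<And>t. t \<in> A \<Longrightarrow> \<gamma> t \<in> K t"
      "\<And>s t. s \<in> A \<Longrightarrow> t \<in> A \<Longrightarrow> dist (\<gamma> s) (\<gamma> t) \<le> C * (L + 1) * dist s t"
    by metis
  show thesis
  proof (rule that)
    show "\<gamma> \<in> A \<rightarrow> M" "\<And>t. t \<in> A \<Longrightarrow> f (\<gamma> t) = g t"
      using \<gamma>(1) by (auto simp: K_def)
    show "(C * (L + 1))-lipschitz_on A \<gamma>"
      using \<gamma>(2) C(1) L(1) by (intro lipschitz_onI) auto
  qed
qed

lemma bilipschitz_on_imp_lipschitz_on:
  assumes "bilipschitz_on A g"
  shows "\<exists>L. L-lipschitz_on A g"
proof -
  obtain C where C: "\<And>x y. x \<in> A \<Longrightarrow> y \<in> A \<Longrightarrow> dist (g x) (g y) \<le> C * dist x y"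
    using assms unfolding bilipschitz_on_def by blast
  \<comment> \<open>The upper constant of \<open>bilipschitz_on\<close> may be negative if
    \<open>A\<close> has at most one point, whereas \<open>lipschitz_on\<close> demands a
    nonnegative one.\<close>
  have "\<bar>C\<bar>-lipschitz_on A g"
  proof (rule lipschitz_onI)
    fix x y assume "x \<in> A" "y \<in> A"
    then have "dist (g x) (g y) \<le> C * dist x y"
      by (rule C)
    also have "\<dots> \<le> \<bar>C\<bar> * dist x y"
      by (intro mult_right_mono) auto
    finally show "dist (g x) (g y) \<le> \<bar>C\<bar> * dist x y" .
  qed simp
  then show ?thesis by blast
qed

lemma bilipschitz_on_lift:
  assumes f: "L-lipschitz_on M f" and g: "bilipschitz_on A g"
    and \<gamma>: "\<gamma> \<in> A \<rightarrow> M" "\<And>t. t \<in> A \<Longrightarrow> f (\<gamma> t) = g t" "C-lipschitz_on A \<gamma>"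
  shows "bilipschitz_on A \<gamma>"
proof -
  obtain c where c: "0 < c" "\<And>x y. x \<in> A \<Longrightarrow> y \<in> A \<Longrightarrow> c * dist x y \<le> dist (g x) (g y)"
    using g unfolding bilipschitz_on_def by blast
  \<comment> \<open>The lower constant of \<open>\<gamma>\<close> is that of \<open>g\<close>
    divided by a Lipschitz constant of \<open>f\<close>; enlarging \<open>L\<close> by 1 avoids
    division by zero.\<close>
  have L: "0 < L + 1"
    using lipschitz_on_nonneg[OF f] by simp
  have "c / (L + 1) * dist x y \<le> dist (\<gamma> x) (\<gamma> y)" if xy: "x \<in> A" "y \<in> A" for x y
  proof -
    have "c * dist x y \<le> dist (f (\<gamma> x)) (f (\<gamma> y))"
      using c(2) \<gamma>(2) xy by simp
    also have "\<dots> \<le> L * dist (\<gamma> x) (\<gamma> y)"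
      using lipschitz_onD[OF f] \<gamma>(1) xy by blast
    also have "\<dots> \<le> (L + 1) * dist (\<gamma> x) (\<gamma> y)"
      by (simp add: mult_right_mono)
    finally show ?thesis
      using L by (simp add: field_simps)
  qed
  moreover have "0 < c / (L + 1)"
    using c(1) L by simp
  ultimately show ?thesis
    unfolding bilipschitz_on_def using lipschitz_onD[OF \<gamma>(3)] by blast
qed

theorem theorem3:
  fixes M :: "'a::metric_space set" and N :: "'b::metric_space set"
  assumes "M \<noteq> {}"
    and "compact M"
    and "purely_1_unrectifiable M"
    and "lipschitz_quotient M N"
  shows "purely_1_unrectifiable N"
  unfolding purely_1_unrectifiable_def
proof
  assume "\<exists>(A::real set) g. A \<in> sets lebesgue \<and> emeasure lebesgue A > 0 \<and>
    g \<in> A \<rightarrow> N \<and> bilipschitz_on A g"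
  then obtain A :: "real set" and g
    where A: "A \<in> sets lebesgue" "emeasure lebesgue A > 0"
      and g: "g \<in> A \<rightarrow> N" "bilipschitz_on A g"
    by blast
  obtain f L where f: "L-lipschitz_on M f" "co_lipschitz M N f"
    using assms(4) unfolding lipschitz_quotient_def lipschitz_quotient_map_def by blast
  obtain L' where "L'-lipschitz_on A g"
    using bilipschitz_on_imp_lipschitz_on[OF g(2)] by blast
  then obtain \<gamma> C where \<gamma>: "\<gamma> \<in> A \<rightarrow> M" "\<And>t. t \<in> A \<Longrightarrow> f (\<gamma> t) = g t" "C-lipschitz_on A \<gamma>"
    using lipschitz_lift[OF assms(2,1) lipschitz_on_continuous_on[OF f(1)] f(2) _ g(1)] by metis
  \<comment> \<open>The lift has the same domain \<open>A\<close>, so measurability and positive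
    measure carry over and \<open>\<gamma>\<close> contradicts the unrectifiability of
    \<open>M\<close>.\<close>
  have "bilipschitz_on A \<gamma>"
    using bilipschitz_on_lift[OF f(1) g(2) \<gamma>] .
  then show False
    using assms(3) A \<gamma>(1) unfolding purely_1_unrectifiable_def by blast
qed

end
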